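(* Let $\alpha=\{\alpha_1,\ldots,\alpha_p\}$ be any partition of $n$. Let $V_1=I$ and, for $t\ge 1$, $V_{t+1}=\mathrm{chol}(X_t^\star)$, where $X_t^\star$ is an optimal solution (in the variable $X$) of the inner approximation problem $(\mathrm{In}_t)$ with matrix $V_t$, and let $\mathsf{U}_\alpha^t$ denote the optimal value of $(\mathrm{In}_t)$. If, at iteration $t$, $X_t^\star$ is positive definite and $\mathsf{U}^{t}_{\alpha}>p^\star$, then $$\mathsf{U}^{t}_{\alpha}>\mathsf{U}^{t+1}_{\alpha}\geq p^\star .$$
   Context: $\mathbb{S}^n$ is the set of real symmetric $n\times n$ matrices, $\mathbb{S}^n_+$ the set of positive semidefinite ones, $\langle A,B\rangle=\mathrm{tr}(AB)$ on $\mathbb{S}^n$. Problem data: $b\in\mathbb{R}^m$, $C,A_1,\ldots,A_m\in\mathbb{S}^n$. The primal and dual semidefinite programs are $$p^\star=\min_X\{\langle C,X\rangle : \langle A_i,X\rangle=b_i,\ i=1,\ldots,m,\ X\in\mathbb{S}^n_+\},$$ $$d^\star=\max_{y,Z}\{b^{\mathsf T}y : Z+\textstyle\sum_{i=1}^m A_iy_i=C,\ Z\in\mathbb{S}^n_+\},$$ and strong duality $p^\star=d^\star$ is assumed. A partition of $n$ is $\alpha=\{\alpha_1,\ldots,\alpha_p\}$ with positive integers $\alpha_i$, $\sum_{i=1}^p\alpha_i=n$. Let $E_i^\alpha=\begin{bmatrix}0&\cdots&I_{\alpha_i}&\cdots&0\end{bmatrix}\in\mathbb{R}^{\alpha_i\times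 n}$ (identity in the $i$-th block position) and, for $i\neq j$, $E_{ij}^\alpha=\begin{bmatrix}E_i^\alpha \\ E_j^\alpha\end{bmatrix}\in\mathbb{R}^{(\alpha_i+\alpha_j)\times n}$. The cone of block factor-width-two matrices is $$\mathcal{FW}^n_{\alpha,2}=\Big\{\sum_{1\le k<l\le p}(E_{kl}^\alpha)^{\mathsf T}X_{kl}E_{kl}^\alpha : X_{kl}\in\mathbb{S}^{\alpha_k+\alpha_l}_+\Big\},$$ and for an $n\times n$ matrix $V$, $\mathcal{FW}^n_{\alpha,2}(V)=\{V^{\mathsf T}QV : Q\in\mathcal{FW}^n_{\alpha,2}\}$. Inner approximation problem $(\mathrm{In}_t)$ at iteration $t$, with matrix $V_t\in\mathbb{R}^{n\times n}$: $$\mathsf{U}_\alpha^t=\min_{X}\{\langle C,X\rangle:\langle A_i,X\rangle=b_i,\ i=1,\ldots,m,\ X\in\mathcal{FW}^n_{\alpha,2}(V_t)\}.$$ Equivalently, in variables $X_{kl}\in\mathbb{S}^{\alpha_k+\alpha_l}_+$, $1\le k<l\le p$: minimize $\sum_{k<l}\langle \hat C_{kl},X_{kl}\rangle$ subject to $\sum_{k<l}\langle\hat A_{i,kl},X_{kl}\rangle=b_i$ for all $i$, where $\hat C_{kl}=E_{kl}^\alpha V_tCV_t^{\mathsf T}(E_{kl}^\alpha)^{\mathsf T}$ and $\hat A_{i,kl}=E_{kl}^\alpha V_tA_iV_t^{\mathsf T}(E_{kl}^\alpha)^{\mathsf T}$; if $X_{kl}^{t,\star}$ is an optimal solution in these variables,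 then $X_t^\star=\sum_{k<l}V_t^{\mathsf T}(E_{kl}^\alpha)^{\mathsf T}X_{kl}^{t,\star}E_{kl}^\alpha V_t$. For $X\in\mathbb{S}^n_+$, $\mathrm{chol}(X)$ denotes a Cholesky factor of $X$, i.e. an upper triangular $V\in\mathbb{R}^{n\times n}$ with $X=V^{\mathsf T}V$. Standing assumption: the first problem $(\mathrm{In}_1)$ (with $V_1=I$) is feasible, and optimal solutions $X_t^\star$ of the problems $(\mathrm{In}_t)$ exist, so that the sequence $\{V_t\}$ is well defined. *)

theory Defs
  imports
    "HOL-Library.Extended_Real"
    "Jordan_Normal_Form.Matrix"
begin

section \<open>Symmetric and positive (semi)definite matrices\<close>

definition sym_mats :: "nat \<Rightarrow> real mat set" where
  "sym_mats n = {M \<in> carrier_mat n n. M\<^sup>T = M}"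

definition psd_mats :: "nat \<Rightarrow> real mat set" where
  "psd_mats n = {M \<in> sym_mats n. \<forall>x \<in> carrier_vec n. 0 \<le> x \<bullet> (M *\<^sub>v x)}"

definition pd_mats :: "nat \<Rightarrow> real mat set" where
  "pd_mats n = {M \<in> sym_mats n. \<forall>x \<in> carrier_vec n. x \<noteq> 0\<^sub>v n \<longrightarrow> 0 < x \<bullet> (M *\<^sub>v x)}"

definition mat_trace :: "real mat \<Rightarrow> real" where
  "mat_trace M = (\<Sum>i<dim_row M. M $$ (i, i))"

definition mat_inner :: "real mat \<Rightarrow> real mat \<Rightarrow> real" where
  "mat_inner M N = mat_trace (M * N)"

text \<open>Matrices carry their dimensions as data and form no additive monoid as a type; sums of
  \<open>n \<times> n\<close> matrices are therefore taken in the module of \<open>n \<times> n\<close> matrices.\<close>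

definition mat_sum :: "nat \<Rightarrow> ('i \<Rightarrow> real mat) \<Rightarrow> 'i set \<Rightarrow> real mat" where
  "mat_sum n f I = finsum (module_mat TYPE(real) n n) f I"

text \<open>A relation rather than a function: no sign condition is put on the diagonal, and even with one
  the factor of a singular matrix would not be unique.\<close>

definition is_cholesky_factor :: "nat \<Rightarrow> real mat \<Rightarrow> real mat \<Rightarrow> bool" where
  "is_cholesky_factor n X V \<longleftrightarrow> V \<in> carrier_mat n n \<and> upper_triangular V \<and> X = V\<^sup>T * V"

section \<open>Block factor-width-two matrices\<close>

text \<open>The blocks of a partition are ordered, so a partition is a list. All indices (of matrices,
  vectors, blocks and constraints) start at 0.\<close>

definition is_partition :: "nat \<Rightarrow> nat list \<Rightarrow> bool" where
  "is_partition n \<alpha> \<longleftrightarrow> (\<forall>a \<in> set \<alpha>. 0 < a) \<and> sum_list \<alpha> = n"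

text \<open>Block \<open>i\<close> occupies the indices from \<open>\<alpha>\<^sub>0 + \<dots> + \<alpha>\<^sub>i\<^sub>-\<^sub>1\<close> on.\<close>

definition E_block :: "nat list \<Rightarrow> nat \<Rightarrow> real mat" where
  "E_block \<alpha> i = mat (\<alpha> ! i) (sum_list \<alpha>)
     (\<lambda>(r, c). if c = sum_list (take i \<alpha>) + r then 1 else 0)"

definition E_pair :: "nat list \<Rightarrow> nat \<Rightarrow> nat \<Rightarrow> real mat" where
  "E_pair \<alpha> i j = E_block \<alpha> i @\<^sub>r E_block \<alpha> j"

definition block_pairs :: "nat list \<Rightarrow> (nat \<times> nat) set" where
  "block_pairs \<alpha> = {(k, l). k < l \<and> l < length \<alpha>}"

definition fw2 :: "nat \<Rightarrow> nat list \<Rightarrow> real mat set" where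
  "fw2 n \<alpha> = {mat_sum n (\<lambda>(k, l). (E_pair \<alpha> k l)\<^sup>T * Y k l * E_pair \<alpha> k l) (block_pairs \<alpha>) | Y.
     \<forall>(k, l) \<in> block_pairs \<alpha>. Y k l \<in> psd_mats (\<alpha> ! k + \<alpha> ! l)}"

definition fw2_basis :: "nat \<Rightarrow> nat list \<Rightarrow> real mat \<Rightarrow> real mat set" where
  "fw2_basis n \<alpha> V = {V\<^sup>T * Q * V | Q. Q \<in> fw2 n \<alpha>}"

section \<open>The semidefinite programs and the inner approximation\<close>

definition primal_feasible ::
  "nat \<Rightarrow> nat \<Rightarrow> (nat \<Rightarrow> real mat) \<Rightarrow> real vec \<Rightarrow> real mat set" where
  "primal_feasible n m A b = {X \<in> psd_mats n. \<forall>i<m. mat_inner (A i) X = b $ i}"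

definition dual_feasible ::
  "nat \<Rightarrow> nat \<Rightarrow> (nat \<Rightarrow> real mat) \<Rightarrow> real mat \<Rightarrow> (real vec \<times> real mat) set" where
  "dual_feasible n m A C = {(y, Z). y \<in> carrier_vec m \<and> Z \<in> psd_mats n \<and>
     Z + mat_sum n (\<lambda>i. y $ i \<cdot>\<^sub>m A i) {..<m} = C}"

definition inner_feasible ::
  "nat \<Rightarrow> nat \<Rightarrow> (nat \<Rightarrow> real mat) \<Rightarrow> real vec \<Rightarrow> nat list \<Rightarrow> real mat \<Rightarrow> real mat set" where
  "inner_feasible n m A b \<alpha> V = {X \<in> fw2_basis n \<alpha> V. \<forall>i<m. mat_inner (A i) X = b $ i}"

text \<open>Optimal values are extended reals, with the usual conventions for infeasible and unbounded
  programs; when an optimum is attained they are the minimum or maximum.\<close>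

definition primal_value ::
  "nat \<Rightarrow> nat \<Rightarrow> (nat \<Rightarrow> real mat) \<Rightarrow> real vec \<Rightarrow> real mat \<Rightarrow> ereal" where
  "primal_value n m A b C = (INF X \<in> primal_feasible n m A b. ereal (mat_inner C X))"

definition dual_value ::
  "nat \<Rightarrow> nat \<Rightarrow> (nat \<Rightarrow> real mat) \<Rightarrow> real vec \<Rightarrow> real mat \<Rightarrow> ereal" where
  "dual_value n m A b C = (SUP (y, Z) \<in> dual_feasible n m A C. ereal (b \<bullet> y))"

definition inner_value ::
  "nat \<Rightarrow> nat \<Rightarrow> (nat \<Rightarrow> real mat) \<Rightarrow> real vec \<Rightarrow> real mat \<Rightarrow> nat list \<Rightarrow> real mat \<Rightarrow> ereal" where
  "inner_value n m A b C \<alpha> V = (INF X \<in> inner_feasible n m A b \<alpha> V. ereal (mat_inner C X))"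

definition inner_optimal ::
  "nat \<Rightarrow> nat \<Rightarrow> (nat \<Rightarrow> real mat) \<Rightarrow> real vec \<Rightarrow> real mat \<Rightarrow> nat list \<Rightarrow> real mat \<Rightarrow> real mat \<Rightarrow> bool"
  where
  "inner_optimal n m A b C \<alpha> V X \<longleftrightarrow>
     is_arg_min (mat_inner C) (\<lambda>Y. Y \<in> inner_feasible n m A b \<alpha> V) X"

end

theory Submission
  imports Defs "Jordan_Normal_Form.Determinant"
begin

text \<open>Write \<open>X = X\<^sub>t = V\<^sup>T V\<close> with \<open>V = V\<^sub>t\<^sub>+\<^sub>1\<close>. In the coordinates given by \<open>V\<close> the current optimum \<open>X\<close>
  becomes the identity, and the identity is an interior point (within the symmetric matrices) of the
  cone of block factor-width-two matrices as soon as there are two blocks. Hence \<open>X\<close> can be moved a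
  little towards any symmetric matrix without leaving the cone of the problem at \<open>t + 1\<close>
  (\<open>step_towards_symmetric_matrix\<close>). As the value at \<open>t\<close> exceeds the primal value, some primal
  feasible \<open>Y\<close> has smaller cost than \<open>X\<close>; a short step from \<open>X\<close> towards \<open>Y\<close> keeps the linear
  constraints and strictly decreases the linear cost.

  Interiority is proved in the form that the identity is an order unit: every symmetric \<open>S\<close> satisfies
  \<open>S + c I \<in> FW\<close> for some \<open>c \<ge> 0\<close> (\<open>identity_order_unit_fw2\<close>). Any two indices lie in the union of
  two blocks, so the cone contains all squares \<open>u u\<^sup>T\<close> of vectors \<open>u\<close> supported on at most two
  indices; sums of such squares reach every off-diagonal part, and every nonnegative diagonal matrix.

  With fewer than two blocks there are no block pairs, so the cone is \<open>{0}\<close>; then a positive definite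
  \<open>X\<close> exists only for \<open>n = 0\<close>, where all feasible points coincide and no gap to the primal value is
  possible. The lower bound holds because the inner cones consist of positive semidefinite matrices.\<close>

section \<open>Sums and linear functionals of matrices\<close>

text \<open>The set \<open>K\<close> is a variable so that one induction serves the positive semidefinite matrices, the
  block factor-width-two matrices and the full space of \<open>n \<times> n\<close> matrices.\<close>

lemma mat_sum_in_cone:
  assumes "finite I"
    and "K \<subseteq> carrier_mat n n" "0\<^sub>m n n \<in> K"
    and add: "\<And>M N. M \<in> K \<Longrightarrow> N \<in> K \<Longrightarrow> M + N \<in> K"
    and "\<And>i. i \<in> I \<Longrightarrow> f i \<in> K"
  shows "mat_sum n f I \<in> K"
proof -
  interpret abelian_group "module_mat TYPE(real) n n" by (rule abelian_group_mat)
  show ?thesis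
    using assms(1,5)
  proof (induction I rule: finite_induct)
    case empty
    then show ?case using assms(3) by (simp add: mat_sum_def module_mat_simps)
  next
    case (insert i I)
    have "mat_sum n f (insert i I) = f i + mat_sum n f I"
      unfolding mat_sum_def
      by (subst finsum_insert) (use insert assms(2) in \<open>auto simp: module_mat_simps\<close>)
    then show ?case using insert by (auto intro: add)
  qed
qed

lemma index_mat_sum:
  assumes "finite I" "\<And>i. i \<in> I \<Longrightarrow> f i \<in> carrier_mat n n" "a < n" "c < n"
  shows "mat_sum n f I $$ (a, c) = (\<Sum>i\<in>I. f i $$ (a, c))"
proof -
  interpret abelian_group "module_mat TYPE(real) n n" by (rule abelian_group_mat)
  show ?thesis
    using assms(1,2)
  proof (induction I rule: finite_induct)
    case empty
    then show ?case using assms(3,4) by (simp add: mat_sum_def module_mat_simps)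
  next
    case (insert i I)
    have "mat_sum n f (insert i I) = f i + mat_sum n f I"
      unfolding mat_sum_def
      by (subst finsum_insert) (use insert in \<open>auto simp: module_mat_simps\<close>)
    moreover have "mat_sum n f I \<in> carrier_mat n n"
      using insert by (intro mat_sum_in_cone[where K = "carrier_mat n n"]) auto
    ultimately show ?case using insert assms(3,4) by simp
  qed
qed

lemma mat_sum_carrier:
  assumes "finite I" "\<And>i. i \<in> I \<Longrightarrow> f i \<in> carrier_mat n n"
  shows "mat_sum n f I \<in> carrier_mat n n"
  using assms by (intro mat_sum_in_cone[where K = "carrier_mat n n"]) auto

lemma one_smult_mat: "(1 :: real) \<cdot>\<^sub>m M = M"
  by (rule eq_matI) auto

lemma zero_mult_mat_vec:
  fixes v :: "real vec"
  shows "v \<in> carrier_vec n \<Longrightarrow> 0\<^sub>m n n *\<^sub>v v = 0\<^sub>v n"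
  by (intro eq_vecI) auto

lemma mat_inner_lincomb:
  assumes "M \<in> carrier_mat n n" "X \<in> carrier_mat n n" "Y \<in> carrier_mat n n"
  shows "mat_inner M (x \<cdot>\<^sub>m X + y \<cdot>\<^sub>m Y) = x * mat_inner M X + y * mat_inner M Y"
proof -
  have "M * (x \<cdot>\<^sub>m X + y \<cdot>\<^sub>m Y) = x \<cdot>\<^sub>m (M * X) + y \<cdot>\<^sub>m (M * Y)"
    using assms by (simp add: mult_add_distrib_mat[of M n n _ n] mult_smult_distrib[of M n n _ n])
  then show ?thesis
    using assms by (simp add: mat_inner_def mat_trace_def sum.distrib sum_distrib_left)
qed

text \<open>Congruence is linear in the middle factor. This turns a statement about \<open>Q\<close> in the cone into one
  about \<open>V\<^sup>T Q V\<close> in the transformed cone.\<close>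

lemma lincomb_congruence:
  fixes B :: "real mat"
  assumes "B \<in> carrier_mat k n" "M \<in> carrier_mat k k" "N \<in> carrier_mat k k"
  shows "B\<^sup>T * (x \<cdot>\<^sub>m M + y \<cdot>\<^sub>m N) * B = x \<cdot>\<^sub>m (B\<^sup>T * M * B) + y \<cdot>\<^sub>m (B\<^sup>T * N * B)"
proof -
  have BT: "B\<^sup>T \<in> carrier_mat n k" using assms by simp
  show ?thesis
    using assms BT
    by (simp add: mult_add_distrib_mat[of _ n k _ k] mult_smult_distrib[of _ n k _ k]
        add_mult_distrib_mat[of _ n k] mult_smult_assoc_mat[of _ n k _ n])
qed

section \<open>The cone of positive semidefinite matrices\<close>

lemma psd_carrier: "M \<in> psd_mats n \<Longrightarrow> M \<in> carrier_mat n n"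
  by (simp add: psd_mats_def sym_mats_def)

lemma psd_lincomb:
  assumes "M \<in> psd_mats n" "N \<in> psd_mats n" "0 \<le> x" "0 \<le> y"
  shows "x \<cdot>\<^sub>m M + y \<cdot>\<^sub>m N \<in> psd_mats n"
proof -
  have M: "M \<in> carrier_mat n n" "M\<^sup>T = M" and N: "N \<in> carrier_mat n n" "N\<^sup>T = N"
    using assms by (auto simp: psd_mats_def sym_mats_def)
  have "(x \<cdot>\<^sub>m M + y \<cdot>\<^sub>m N)\<^sup>T = x \<cdot>\<^sub>m M\<^sup>T + y \<cdot>\<^sub>m N\<^sup>T"
    using M(1) N(1) by (intro eq_matI) auto
  moreover have "0 \<le> v \<bullet> ((x \<cdot>\<^sub>m M + y \<cdot>\<^sub>m N) *\<^sub>v v)" if v: "v \<in> carrier_vec n" for v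
  proof -
    have "(x \<cdot>\<^sub>m M + y \<cdot>\<^sub>m N) *\<^sub>v v = x \<cdot>\<^sub>v (M *\<^sub>v v) + y \<cdot>\<^sub>v (N *\<^sub>v v)"
      using M(1) N(1) v
      by (intro eq_vecI) (auto simp: add_scalar_prod_distrib[of _ n])
    moreover have "v \<bullet> (x \<cdot>\<^sub>v (M *\<^sub>v v) + y \<cdot>\<^sub>v (N *\<^sub>v v)) = x * (v \<bullet> (M *\<^sub>v v)) + y * (v \<bullet> (N *\<^sub>v v))"
      using M(1) N(1) v by (simp add: scalar_prod_add_distrib[of _ n])
    ultimately show ?thesis using assms v by (simp add: psd_mats_def)
  qed
  ultimately show ?thesis using M N by (simp add: psd_mats_def sym_mats_def)
qed

lemma psd_zero: "0\<^sub>m n n \<in> psd_mats n"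
  by (auto simp: psd_mats_def sym_mats_def zero_mult_mat_vec)

lemma psd_add: "M \<in> psd_mats n \<Longrightarrow> N \<in> psd_mats n \<Longrightarrow> M + N \<in> psd_mats n"
  using psd_lincomb[of M n N 1 1] by (simp add: one_smult_mat)

lemma sym_congruence:
  fixes B :: "real mat"
  assumes "B \<in> carrier_mat k n" "M \<in> sym_mats k"
  shows "B\<^sup>T * M * B \<in> sym_mats n"
proof -
  have "(B\<^sup>T * M * B)\<^sup>T = B\<^sup>T * (M\<^sup>T * B)"
    using assms by (simp add: transpose_mult[of _ n k _ n] transpose_mult[of _ n k _ k] sym_mats_def)
  then show ?thesis
    using assms by (auto simp: sym_mats_def assoc_mult_mat[of _ n k _ k _ n])
qed

lemma quadratic_form_congruence:
  fixes B :: "real mat"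
  assumes "B \<in> carrier_mat k n" "M \<in> carrier_mat k k" "v \<in> carrier_vec n"
  shows "v \<bullet> (B\<^sup>T * M * B *\<^sub>v v) = (B *\<^sub>v v) \<bullet> (M *\<^sub>v (B *\<^sub>v v))"
proof -
  have "B\<^sup>T * M * B *\<^sub>v v = B\<^sup>T *\<^sub>v (M *\<^sub>v (B *\<^sub>v v))"
    using assms by (simp add: assoc_mult_mat_vec[of _ n k _ k] assoc_mult_mat_vec[of _ n k _ n])
  moreover have "(B\<^sup>T *\<^sub>v (M *\<^sub>v (B *\<^sub>v v))) \<bullet> v = (M *\<^sub>v (B *\<^sub>v v)) \<bullet> (B *\<^sub>v v)"
    using assms by (intro transpose_vec_mult_scalar) auto
  ultimately show ?thesis
    using assms by (simp add: comm_scalar_prod[of v n] comm_scalar_prod[of "B *\<^sub>v v" k])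
qed

lemma psd_congruence:
  assumes "B \<in> carrier_mat k n" "M \<in> psd_mats k"
  shows "B\<^sup>T * M * B \<in> psd_mats n"
  using assms sym_congruence[of B k n M]
  by (auto simp: psd_mats_def sym_mats_def quadratic_form_congruence)

definition outer_square :: "real vec \<Rightarrow> real mat" where
  "outer_square v = mat (dim_vec v) (dim_vec v) (\<lambda>(i, j). v $ i * v $ j)"

lemma outer_square_carrier: "v \<in> carrier_vec n \<Longrightarrow> outer_square v \<in> carrier_mat n n"
  by (auto simp: outer_square_def)

text \<open>The quadratic form of \<open>v v\<^sup>T\<close> at \<open>x\<close> is the square of \<open>v \<bullet> x\<close>.\<close>

lemma outer_square_psd:
  assumes v: "v \<in> carrier_vec n"
  shows "outer_square v \<in> psd_mats n"
proof -
  have "(outer_square v)\<^sup>T = outer_square v"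
    by (intro eq_matI) (auto simp: outer_square_def)
  moreover have "x \<bullet> (outer_square v *\<^sub>v x) = (v \<bullet> x)\<^sup>2" if x: "x \<in> carrier_vec n" for x
  proof -
    have "outer_square v *\<^sub>v x = (v \<bullet> x) \<cdot>\<^sub>v v"
      using v x by (intro eq_vecI) (auto simp: outer_square_def scalar_prod_def sum_distrib_left mult_ac)
    then show ?thesis
      using v x by (simp add: comm_scalar_prod[of x n] power2_eq_square)
  qed
  ultimately show ?thesis
    using v by (simp add: psd_mats_def sym_mats_def outer_square_carrier)
qed

lemma outer_square_congruence:
  assumes "B \<in> carrier_mat k n" "w \<in> carrier_vec k"
  shows "B\<^sup>T * outer_square w * B = outer_square (B\<^sup>T *\<^sub>v w)"
proof (rule eq_matI)
  fix i j assume "i < dim_row (outer_square (B\<^sup>T *\<^sub>v w))" "j < dim_col (outer_square (B\<^sup>T *\<^sub>v w))"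
  then have ij: "i < n" "j < n" using assms by (auto simp: outer_square_def)
  have "(B\<^sup>T * outer_square w * B) $$ (i, j)
      = (\<Sum>s<k. (\<Sum>r<k. B $$ (r, i) * (w $ r * w $ s)) * B $$ (s, j))"
    using assms ij by (simp add: scalar_prod_def outer_square_def atLeast0LessThan)
  also have "\<dots> = (\<Sum>s<k. (\<Sum>r<k. B $$ (r, i) * w $ r) * (B $$ (s, j) * w $ s))"
    by (simp add: sum_distrib_right sum_distrib_left mult_ac)
  also have "\<dots> = (\<Sum>r<k. B $$ (r, i) * w $ r) * (\<Sum>s<k. B $$ (s, j) * w $ s)"
    by (simp add: sum_distrib_left)
  also have "\<dots> = outer_square (B\<^sup>T *\<^sub>v w) $$ (i, j)"
    using assms ij by (simp add: scalar_prod_def outer_square_def atLeast0LessThan)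
  finally show "(B\<^sup>T * outer_square w * B) $$ (i, j) = outer_square (B\<^sup>T *\<^sub>v w) $$ (i, j)" .
qed (use assms in \<open>auto simp: outer_square_def\<close>)

section \<open>The cone of block factor-width-two matrices\<close>

lemma finite_block_pairs: "finite (block_pairs \<alpha>)"
  by (rule finite_subset[of _ "{..<length \<alpha>} \<times> {..<length \<alpha>}"]) (auto simp: block_pairs_def)

lemma E_pair_carrier:
  assumes "is_partition n \<alpha>"
  shows "E_pair \<alpha> k l \<in> carrier_mat (\<alpha> ! k + \<alpha> ! l) n"
  using assms by (auto simp: E_pair_def E_block_def is_partition_def)

lemma pair_term_psd:
  assumes "is_partition n \<alpha>" "M \<in> psd_mats (\<alpha> ! k + \<alpha> ! l)"
  shows "(E_pair \<alpha> k l)\<^sup>T * M * E_pair \<alpha> k l \<in> psd_mats n"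
  using psd_congruence[OF E_pair_carrier[OF assms(1)] assms(2)] .

lemma fw2_subset_psd:
  assumes "is_partition n \<alpha>"
  shows "fw2 n \<alpha> \<subseteq> psd_mats n"
  unfolding fw2_def
  by (auto intro!: mat_sum_in_cone psd_zero psd_add pair_term_psd
      simp: assms finite_block_pairs psd_carrier)

lemma fw2_basis_subset_psd:
  assumes "is_partition n \<alpha>" "V \<in> carrier_mat n n"
  shows "fw2_basis n \<alpha> V \<subseteq> psd_mats n"
  using fw2_subset_psd[OF assms(1)] assms(2) by (auto simp: fw2_basis_def intro: psd_congruence)

text \<open>The map from a family of blocks to the sum of the lifted blocks is linear, and the families of
  positive semidefinite blocks form a convex cone.\<close>

lemma fw2_lincomb:
  assumes part: "is_partition n \<alpha>" and Q: "Q \<in> fw2 n \<alpha>" and R: "R \<in> fw2 n \<alpha>"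
    and "0 \<le> x" "0 \<le> y"
  shows "x \<cdot>\<^sub>m Q + y \<cdot>\<^sub>m R \<in> fw2 n \<alpha>"
proof -
  define lift where "lift Y = (\<lambda>(k, l). (E_pair \<alpha> k l)\<^sup>T * Y k l * E_pair \<alpha> k l)"
    for Y :: "nat \<Rightarrow> nat \<Rightarrow> real mat"
  obtain Y where Y: "\<And>k l. (k, l) \<in> block_pairs \<alpha> \<Longrightarrow> Y k l \<in> psd_mats (\<alpha> ! k + \<alpha> ! l)"
    and Q_eq: "Q = mat_sum n (lift Y) (block_pairs \<alpha>)"
    using Q unfolding fw2_def lift_def by blast
  obtain Z where Z: "\<And>k l. (k, l) \<in> block_pairs \<alpha> \<Longrightarrow> Z k l \<in> psd_mats (\<alpha> ! k + \<alpha> ! l)"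
    and R_eq: "R = mat_sum n (lift Z) (block_pairs \<alpha>)"
    using R unfolding fw2_def lift_def by blast
  define W where "W k l = x \<cdot>\<^sub>m Y k l + y \<cdot>\<^sub>m Z k l" for k l
  have W: "W k l \<in> psd_mats (\<alpha> ! k + \<alpha> ! l)" if "(k, l) \<in> block_pairs \<alpha>" for k l
    unfolding W_def using that Y Z assms by (intro psd_lincomb) auto
  have lift_carrier: "lift U kl \<in> carrier_mat n n"
    if "kl \<in> block_pairs \<alpha>" "\<And>k l. (k, l) \<in> block_pairs \<alpha> \<Longrightarrow> U k l \<in> psd_mats (\<alpha> ! k + \<alpha> ! l)" for U kl
    using that pair_term_psd[OF part] by (cases kl) (auto simp: lift_def intro!: psd_carrier)
  have lift_W: "lift W kl = x \<cdot>\<^sub>m lift Y kl + y \<cdot>\<^sub>m lift Z kl" if "kl \<in> block_pairs \<alpha>" for kl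
    using that Y Z lincomb_congruence[OF E_pair_carrier[OF part]]
    by (cases kl) (simp add: lift_def W_def psd_carrier)
  have "x \<cdot>\<^sub>m Q + y \<cdot>\<^sub>m R = mat_sum n (lift W) (block_pairs \<alpha>)"
  proof (rule eq_matI)
    have dims: "mat_sum n (lift U) (block_pairs \<alpha>) \<in> carrier_mat n n"
      if "\<And>k l. (k, l) \<in> block_pairs \<alpha> \<Longrightarrow> U k l \<in> psd_mats (\<alpha> ! k + \<alpha> ! l)" for U
      using that by (intro mat_sum_carrier finite_block_pairs lift_carrier)
    note dims' = dims[of Y, OF Y] dims[of Z, OF Z] dims[of W, OF W]
    show "dim_row (x \<cdot>\<^sub>m Q + y \<cdot>\<^sub>m R) = dim_row (mat_sum n (lift W) (block_pairs \<alpha>))"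
      "dim_col (x \<cdot>\<^sub>m Q + y \<cdot>\<^sub>m R) = dim_col (mat_sum n (lift W) (block_pairs \<alpha>))"
      using dims' by (auto simp: Q_eq R_eq)
    fix i j
    assume "i < dim_row (mat_sum n (lift W) (block_pairs \<alpha>))"
      "j < dim_col (mat_sum n (lift W) (block_pairs \<alpha>))"
    then have ij: "i < n" "j < n" using dims' by auto
    have entry: "mat_sum n (lift U) (block_pairs \<alpha>) $$ (i, j) = (\<Sum>kl\<in>block_pairs \<alpha>. lift U kl $$ (i, j))"
      if "\<And>k l. (k, l) \<in> block_pairs \<alpha> \<Longrightarrow> U k l \<in> psd_mats (\<alpha> ! k + \<alpha> ! l)" for U
      using that ij by (intro index_mat_sum finite_block_pairs lift_carrier)
    have "lift W kl $$ (i, j) = x * lift Y kl $$ (i, j) + y * lift Z kl $$ (i, j)"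
      if kl: "kl \<in> block_pairs \<alpha>" for kl
      using lift_W[OF kl] lift_carrier[OF kl Y] lift_carrier[OF kl Z] ij by auto
    then show "(x \<cdot>\<^sub>m Q + y \<cdot>\<^sub>m R) $$ (i, j) = mat_sum n (lift W) (block_pairs \<alpha>) $$ (i, j)"
      using dims' ij entry[of Y, OF Y] entry[of Z, OF Z] entry[of W, OF W]
      by (simp add: Q_eq R_eq sum.distrib sum_distrib_left)
  qed
  then show ?thesis
    using W by (auto simp: fw2_def lift_def)
qed

text \<open>A single lifted block is a member of the cone: take zero for the blocks of all other pairs.\<close>

lemma pair_term_in_fw2:
  assumes part: "is_partition n \<alpha>" and kl: "(k, l) \<in> block_pairs \<alpha>"
    and M: "M \<in> psd_mats (\<alpha> ! k + \<alpha> ! l)"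
  shows "(E_pair \<alpha> k l)\<^sup>T * M * E_pair \<alpha> k l \<in> fw2 n \<alpha>"
proof -
  define Y where "Y k' l' = (if (k', l') = (k, l) then M else 0\<^sub>m (\<alpha> ! k' + \<alpha> ! l') (\<alpha> ! k' + \<alpha> ! l'))"
    for k' l'
  let ?f = "\<lambda>(k, l). (E_pair \<alpha> k l)\<^sup>T * Y k l * E_pair \<alpha> k l"
  have Y: "Y k' l' \<in> psd_mats (\<alpha> ! k' + \<alpha> ! l')" for k' l'
    using M by (auto simp: Y_def psd_zero)
  have f: "?f p \<in> carrier_mat n n" for p
    using pair_term_psd[OF part Y] by (auto intro: psd_carrier split: prod.split)
  have zero: "?f p = 0\<^sub>m n n" if "p \<noteq> (k, l)" for p
  proof (cases p)
    case (Pair k' l')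
    have "(E_pair \<alpha> k' l')\<^sup>T \<in> carrier_mat n (\<alpha> ! k' + \<alpha> ! l')"
      using E_pair_carrier[OF part] by simp
    with that Pair show ?thesis
      using E_pair_carrier[OF part, of k' l'] by (auto simp: Y_def)
  qed
  have "(E_pair \<alpha> k l)\<^sup>T * M * E_pair \<alpha> k l = ?f (k, l)" by (simp add: Y_def)
  also have "\<dots> = mat_sum n ?f (block_pairs \<alpha>)"
  proof (rule eq_matI)
    have S: "mat_sum n ?f (block_pairs \<alpha>) \<in> carrier_mat n n"
      using f by (intro mat_sum_carrier finite_block_pairs)
    show "dim_row (?f (k, l)) = dim_row (mat_sum n ?f (block_pairs \<alpha>))"
      "dim_col (?f (k, l)) = dim_col (mat_sum n ?f (block_pairs \<alpha>))"
      using f[of "(k, l)"] S by auto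
    fix i j assume "i < dim_row (mat_sum n ?f (block_pairs \<alpha>))" "j < dim_col (mat_sum n ?f (block_pairs \<alpha>))"
    then have ij: "i < n" "j < n" using S by auto
    have "mat_sum n ?f (block_pairs \<alpha>) $$ (i, j) = (\<Sum>p\<in>block_pairs \<alpha>. ?f p $$ (i, j))"
      using f ij by (intro index_mat_sum finite_block_pairs)
    also have "\<dots> = (\<Sum>p\<in>block_pairs \<alpha>. if p = (k, l) then ?f (k, l) $$ (i, j) else 0)"
      by (rule sum.cong[OF refl]) (use zero ij in \<open>simp del: split_paired_All\<close>)
    also have "\<dots> = ?f (k, l) $$ (i, j)"
      using kl by (simp add: finite_block_pairs)
    finally show "?f (k, l) $$ (i, j) = mat_sum n ?f (block_pairs \<alpha>) $$ (i, j)" ..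
  qed
  finally show ?thesis using Y by (auto simp: fw2_def)
qed

text \<open>The family of zero blocks gives some member of the cone; scaling it by zero avoids evaluating
  its sum.\<close>

lemma zero_in_fw2:
  assumes part: "is_partition n \<alpha>"
  shows "0\<^sub>m n n \<in> fw2 n \<alpha>"
proof -
  let ?Y = "\<lambda>k l. 0\<^sub>m (\<alpha> ! k + \<alpha> ! l) (\<alpha> ! k + \<alpha> ! l) :: real mat"
  let ?Q = "mat_sum n (\<lambda>(k, l). (E_pair \<alpha> k l)\<^sup>T * ?Y k l * E_pair \<alpha> k l) (block_pairs \<alpha>)"
  have Q: "?Q \<in> fw2 n \<alpha>" by (force simp: fw2_def psd_zero)
  then have "?Q \<in> carrier_mat n n" using fw2_subset_psd[OF part] by (auto intro: psd_carrier)
  then have "0 \<cdot>\<^sub>m ?Q + 0 \<cdot>\<^sub>m ?Q = 0\<^sub>m n n" by (intro eq_matI) auto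
  then show ?thesis using fw2_lincomb[OF part Q Q, of 0 0] by simp
qed

lemma fw2_add:
  assumes "is_partition n \<alpha>" "Q \<in> fw2 n \<alpha>" "R \<in> fw2 n \<alpha>"
  shows "Q + R \<in> fw2 n \<alpha>"
  using fw2_lincomb[OF assms, of 1 1] by (simp add: one_smult_mat)

lemma fw2_smult:
  assumes "is_partition n \<alpha>" "Q \<in> fw2 n \<alpha>" "0 \<le> x"
  shows "x \<cdot>\<^sub>m Q \<in> fw2 n \<alpha>"
proof -
  have "Q \<in> carrier_mat n n" using fw2_subset_psd[OF assms(1)] assms(2) by (auto intro: psd_carrier)
  then have "x \<cdot>\<^sub>m Q + 0 \<cdot>\<^sub>m Q = x \<cdot>\<^sub>m Q" by (intro eq_matI) auto
  then show ?thesis using fw2_lincomb[OF assms(1,2,2,3), of 0] by simp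
qed

lemma block_of_index:
  fixes \<alpha> :: "nat list"
  assumes "i < sum_list \<alpha>"
  shows "\<exists>k < length \<alpha>. \<exists>r < \<alpha> ! k. i = sum_list (take k \<alpha>) + r"
  using assms
proof (induction \<alpha> arbitrary: i)
  case (Cons a \<alpha>)
  show ?case
  proof (cases "i < a")
    case True
    then show ?thesis by (intro exI[of _ 0]) auto
  next
    case False
    then have "i - a < sum_list \<alpha>" using Cons.prems by simp
    from Cons.IH[OF this] obtain k r where "k < length \<alpha>" "r < \<alpha> ! k" "i - a = sum_list (take k \<alpha>) + r"
      by blast
    then show ?thesis using False by (intro exI[of _ "Suc k"]) auto
  qed
qed simp

text \<open>The coordinate vectors of block \<open>k\<close> and of block \<open>l\<close> are in the range of the transpose of the
  selection matrix of the pair, so squares of vectors supported on these blocks can be lifted from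
  the pair.\<close>

lemma unit_vec_in_pair_range:
  assumes part: "is_partition n \<alpha>" and i: "i < n" "i = sum_list (take h \<alpha>) + r" "r < \<alpha> ! h"
    and h: "h = k \<or> h = l"
  shows "\<exists>w \<in> carrier_vec (\<alpha> ! k + \<alpha> ! l). (E_pair \<alpha> k l)\<^sup>T *\<^sub>v w = unit_vec n i"
proof -
  have n: "sum_list \<alpha> = n" using part by (simp add: is_partition_def)
  define s where "s = (if h = k then r else \<alpha> ! k + r)"
  have s: "s < \<alpha> ! k + \<alpha> ! l" using i h by (auto simp: s_def)
  have "(E_pair \<alpha> k l)\<^sup>T *\<^sub>v unit_vec (\<alpha> ! k + \<alpha> ! l) s = unit_vec n i"
  proof (rule eq_vecI)
    fix c assume "c < dim_vec (unit_vec n i)"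
    then have c: "c < n" by simp
    have "((E_pair \<alpha> k l)\<^sup>T *\<^sub>v unit_vec (\<alpha> ! k + \<alpha> ! l) s) $ c = E_pair \<alpha> k l $$ (s, c)"
      using E_pair_carrier[OF part, of k l] c s by simp
    also have "\<dots> = unit_vec n i $ c"
      using i h c s by (auto simp: E_pair_def E_block_def append_rows_def s_def n)
    finally show "((E_pair \<alpha> k l)\<^sup>T *\<^sub>v unit_vec (\<alpha> ! k + \<alpha> ! l) s) $ c = unit_vec n i $ c" .
  qed (use E_pair_carrier[OF part, of k l] in auto)
  then show ?thesis by (intro bexI[of _ "unit_vec (\<alpha> ! k + \<alpha> ! l) s"]) auto
qed

text \<open>Whatever blocks the two indices belong to, some pair of distinct blocks contains both indices.
  The square of the vector is then the lift of the square of its restriction to that pair.\<close>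

lemma two_index_square_in_fw2:
  assumes part: "is_partition n \<alpha>" and "2 \<le> length \<alpha>" and i: "i < n" and j: "j < n"
  shows "outer_square (x \<cdot>\<^sub>v unit_vec n i + y \<cdot>\<^sub>v unit_vec n j) \<in> fw2 n \<alpha>"
proof -
  have n: "sum_list \<alpha> = n" using part by (simp add: is_partition_def)
  obtain g r where g: "g < length \<alpha>" "r < \<alpha> ! g" "i = sum_list (take g \<alpha>) + r"
    using block_of_index i n by blast
  obtain h s where h: "h < length \<alpha>" "s < \<alpha> ! h" "j = sum_list (take h \<alpha>) + s"
    using block_of_index j n by blast
  \<comment> \<open>If both indices are in the same block, any other block completes the pair; this is where two
    blocks are required.\<close>
  obtain k l where kl: "k < l" "l < length \<alpha>" and gh: "g = k \<or> g = l" "h = k \<or> h = l"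
  proof -
    consider "g < h" | "h < g" | "g = h" "0 < g" | "g = 0" "h = 0" by linarith
    then show thesis
      using that[of g h] that[of h g] that[of 0 g] that[of 0 1] g h \<open>2 \<le> length \<alpha>\<close> by cases auto
  qed
  let ?E = "E_pair \<alpha> k l" and ?d = "\<alpha> ! k + \<alpha> ! l"
  obtain v where v: "v \<in> carrier_vec ?d" "?E\<^sup>T *\<^sub>v v = unit_vec n i"
    using unit_vec_in_pair_range[OF part i g(3,2) gh(1)] by blast
  obtain w where w: "w \<in> carrier_vec ?d" "?E\<^sup>T *\<^sub>v w = unit_vec n j"
    using unit_vec_in_pair_range[OF part j h(3,2) gh(2)] by blast
  have E: "?E \<in> carrier_mat ?d n" by (rule E_pair_carrier[OF part])
  then have ET: "?E\<^sup>T \<in> carrier_mat n ?d" by simp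
  let ?u = "x \<cdot>\<^sub>v v + y \<cdot>\<^sub>v w"
  have u: "?u \<in> carrier_vec ?d" using v w by simp
  have "?E\<^sup>T *\<^sub>v ?u = x \<cdot>\<^sub>v unit_vec n i + y \<cdot>\<^sub>v unit_vec n j"
    using v w ET by (simp add: mult_add_distrib_mat_vec[OF ET] mult_mat_vec[OF ET])
  then have "outer_square (x \<cdot>\<^sub>v unit_vec n i + y \<cdot>\<^sub>v unit_vec n j) = ?E\<^sup>T * outer_square ?u * ?E"
    using outer_square_congruence[OF E u] by simp
  also have "\<dots> \<in> fw2 n \<alpha>"
    using kl by (intro pair_term_in_fw2[OF part] outer_square_psd u) (simp add: block_pairs_def)
  finally show ?thesis .
qed

lemma nonneg_diagonal_in_fw2:
  assumes part: "is_partition n \<alpha>" and "2 \<le> length \<alpha>" and d: "\<And>i. i < n \<Longrightarrow> 0 \<le> d i"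
  shows "mat n n (\<lambda>(i, j). if i = j then d i else 0) \<in> fw2 n \<alpha>"
proof -
  let ?f = "\<lambda>i. d i \<cdot>\<^sub>m outer_square (1 \<cdot>\<^sub>v unit_vec n i + 0 \<cdot>\<^sub>v unit_vec n i)"
  have f: "?f i \<in> fw2 n \<alpha>" if "i < n" for i
    using that assms by (intro fw2_smult two_index_square_in_fw2) auto
  have fc: "?f i \<in> carrier_mat n n" for i
    by (simp add: outer_square_def)
  have "mat_sum n ?f {..<n} \<in> fw2 n \<alpha>"
    using f fw2_subset_psd[OF part]
    by (intro mat_sum_in_cone zero_in_fw2 fw2_add part) (auto simp: psd_carrier)
  moreover have "mat_sum n ?f {..<n} = mat n n (\<lambda>(i, j). if i = j then d i else 0)"
  proof (rule eq_matI)
    fix a c assume "a < dim_row (mat n n (\<lambda>(i, j). if i = j then d i else 0))"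
      "c < dim_col (mat n n (\<lambda>(i, j). if i = j then d i else 0))"
    then have ac: "a < n" "c < n" by auto
    have "mat_sum n ?f {..<n} $$ (a, c) = (\<Sum>i<n. ?f i $$ (a, c))"
      using fc ac by (intro index_mat_sum) auto
    also have "\<dots> = (\<Sum>i<n. if i = a then (if a = c then d a else 0) else 0)"
      by (rule sum.cong) (use ac in \<open>auto simp: outer_square_def\<close>)
    finally show "mat_sum n ?f {..<n} $$ (a, c) = mat n n (\<lambda>(i, j). if i = j then d i else 0) $$ (a, c)"
      using ac by simp
  qed (use mat_sum_carrier[of "{..<n}" ?f n] fc in auto)
  ultimately show ?thesis by simp
qed

text \<open>The square of \<open>e\<^sub>i + \<sigma> e\<^sub>j\<close>, with \<open>\<sigma>\<close> the sign of the entry \<open>s\<^sub>i\<^sub>j\<close>, has \<open>\<sigma>\<close> as its off-diagonal entry. Scaled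
  by \<open>|s\<^sub>i\<^sub>j|\<close>, it produces the entries \<open>s\<^sub>i\<^sub>j\<close> and \<open>s\<^sub>j\<^sub>i\<close> and otherwise changes only the diagonal.\<close>

lemma fw2_contains_symmetric_up_to_diagonal:
  assumes part: "is_partition n \<alpha>" and "2 \<le> length \<alpha>" and S: "S \<in> sym_mats n"
  shows "\<exists>T \<in> fw2 n \<alpha>. \<forall>a < n. \<forall>c < n. a \<noteq> c \<longrightarrow> T $$ (a, c) = S $$ (a, c)"
proof -
  let ?s = "\<lambda>i j. S $$ (i, j)"
  \<comment> \<open>The sum runs over ordered pairs and thus meets every off-diagonal position twice, whence the
    factor one half. Its terms with \<open>i = j\<close> are diagonal matrices and therefore harmless.\<close>
  let ?f = "\<lambda>(i, j). (\<bar>?s i j\<bar> / 2) \<cdot>\<^sub>m outer_square (unit_vec n i + sgn (?s i j) \<cdot>\<^sub>v unit_vec n j)"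
  let ?I = "{..<n} \<times> {..<n}"
  have sym: "?s a c = ?s c a" if "a < n" "c < n" for a c
  proof -
    have S_eq: "S \<in> carrier_mat n n" "S\<^sup>T = S" using S by (simp_all add: sym_mats_def)
    have "S\<^sup>T $$ (a, c) = ?s c a" using that S_eq(1) by auto
    then show ?thesis unfolding S_eq(2) .
  qed
  have f: "?f p \<in> fw2 n \<alpha>" if "p \<in> ?I" for p
    using that two_index_square_in_fw2[OF part assms(2), of _ _ 1] by (auto intro!: fw2_smult[OF part])
  have fc: "?f p \<in> carrier_mat n n" for p
    by (auto simp: outer_square_def split: prod.split)
  have "mat_sum n ?f ?I $$ (a, c) = ?s a c" if ac: "a < n" "c < n" "a \<noteq> c" for a c
  proof -
    have entry: "?f (i, j) $$ (a, c)
        = (if i = a then if j = c then ?s i j / 2 else 0 else 0) +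
          (if i = c then if j = a then ?s i j / 2 else 0 else 0)"
      if "i < n" "j < n" for i j
    proof -
      have "?f (i, j) $$ (a, c) = \<bar>?s i j\<bar> / 2 *
        (((if a = i then 1 else 0) + sgn (?s i j) * (if a = j then 1 else 0)) *
         ((if c = i then 1 else 0) + sgn (?s i j) * (if c = j then 1 else 0)))"
        using that ac by (simp add: outer_square_def)
      also have "\<dots> = (if i = a then if j = c then ?s i j / 2 else 0 else 0) +
          (if i = c then if j = a then ?s i j / 2 else 0 else 0)"
        using ac(3) by (auto simp: abs_mult_sgn)
      finally show ?thesis .
    qed
    have "mat_sum n ?f ?I $$ (a, c) = (\<Sum>p\<in>?I. ?f p $$ (a, c))"
      using fc ac by (intro index_mat_sum) auto
    also have "\<dots> = (\<Sum>i<n. \<Sum>j<n. ?f (i, j) $$ (a, c))"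
      by (simp add: sum.cartesian_product case_prod_beta)
    also have "\<dots> = (\<Sum>i<n. \<Sum>j<n. (if i = a then if j = c then ?s i j / 2 else 0 else 0) +
          (if i = c then if j = a then ?s i j / 2 else 0 else 0))"
      by (intro sum.cong refl entry) auto
    also have "\<dots> = (\<Sum>i<n. if i = a then ?s a c / 2 else 0) + (\<Sum>i<n. if i = c then ?s c a / 2 else 0)"
      unfolding sum.distrib using ac by (intro arg_cong2[of _ _ _ _ "(+)"] sum.cong) auto
    also have "\<dots> = ?s a c" using ac sym[of a c] by simp
    finally show ?thesis .
  qed
  moreover have "mat_sum n ?f ?I \<in> fw2 n \<alpha>"
    using f fw2_subset_psd[OF part]
    by (intro mat_sum_in_cone zero_in_fw2 fw2_add part) (auto intro: psd_carrier)
  ultimately show ?thesis by blast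
qed

text \<open>A member of the cone with the off-diagonal entries of \<open>S\<close> is wrong only on the diagonal, and
  adding a large enough multiple of the identity makes the diagonal correction nonnegative.\<close>

lemma identity_order_unit_fw2:
  assumes part: "is_partition n \<alpha>" and "2 \<le> length \<alpha>" and S: "S \<in> sym_mats n"
  shows "\<exists>c \<ge> 0. S + c \<cdot>\<^sub>m 1\<^sub>m n \<in> fw2 n \<alpha>"
proof -
  obtain T where T: "T \<in> fw2 n \<alpha>" and off: "\<And>a c. a < n \<Longrightarrow> c < n \<Longrightarrow> a \<noteq> c \<Longrightarrow> T $$ (a, c) = S $$ (a, c)"
    using fw2_contains_symmetric_up_to_diagonal[OF assms] by blast
  have Tc: "T \<in> carrier_mat n n" using T fw2_subset_psd[OF part] by (auto intro: psd_carrier)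
  define e where "e i = S $$ (i, i) - T $$ (i, i)" for i
  define c where "c = (\<Sum>i<n. \<bar>e i\<bar>)"
  have "\<bar>e i\<bar> \<le> c" if "i < n" for i
    unfolding c_def using that by (intro member_le_sum) auto
  then have nonneg: "0 \<le> e i + c" if "i < n" for i using that by fastforce
  have "T + mat n n (\<lambda>(i, j). if i = j then e i + c else 0) \<in> fw2 n \<alpha>"
    using nonneg by (intro fw2_add part T nonneg_diagonal_in_fw2 assms)
  moreover have "T + mat n n (\<lambda>(i, j). if i = j then e i + c else 0) = S + c \<cdot>\<^sub>m 1\<^sub>m n"
    using Tc S off by (intro eq_matI) (auto simp: e_def sym_mats_def)
  moreover have "0 \<le> c" by (simp add: c_def sum_nonneg)
  ultimately show ?thesis by auto
qed

text \<open>With \<open>S + c I\<close> in the cone, \<open>\<epsilon> = 1 / (1 + c)\<close> is chosen so that \<open>\<epsilon> c = 1 - \<epsilon>\<close>, and the point on the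
  segment is \<open>\<epsilon> (S + c I)\<close>.\<close>

lemma segment_from_identity_in_fw2:
  assumes part: "is_partition n \<alpha>" and "2 \<le> length \<alpha>" and S: "S \<in> sym_mats n"
  shows "\<exists>\<epsilon> > 0. (1 - \<epsilon>) \<cdot>\<^sub>m 1\<^sub>m n + \<epsilon> \<cdot>\<^sub>m S \<in> fw2 n \<alpha>"
proof -
  obtain c where c: "0 \<le> c" "S + c \<cdot>\<^sub>m 1\<^sub>m n \<in> fw2 n \<alpha>"
    using identity_order_unit_fw2[OF assms] by blast
  define \<epsilon> where "\<epsilon> = 1 / (1 + c)"
  have \<epsilon>: "0 < \<epsilon>" "\<epsilon> * c = 1 - \<epsilon>" using c by (auto simp: \<epsilon>_def field_simps)
  have "\<epsilon> \<cdot>\<^sub>m (S + c \<cdot>\<^sub>m 1\<^sub>m n) = (1 - \<epsilon>) \<cdot>\<^sub>m 1\<^sub>m n + \<epsilon> \<cdot>\<^sub>m S"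
    using S \<epsilon>(2) by (intro eq_matI) (auto simp: sym_mats_def algebra_simps)
  then show ?thesis
    using fw2_smult[OF part c(2), of \<epsilon>] \<epsilon>(1) by auto
qed

section \<open>Strict decrease\<close>

lemma gram_factor_invertible:
  assumes "V \<in> carrier_mat n n" "V\<^sup>T * V \<in> pd_mats n"
  shows "\<exists>B \<in> carrier_mat n n. B * V = 1\<^sub>m n"
proof -
  have "det V \<noteq> 0"
  proof
    assume "det V = 0"
    then obtain v where v: "v \<in> carrier_vec n" "v \<noteq> 0\<^sub>v n" "V *\<^sub>v v = 0\<^sub>v n"
      using det_0_iff_vec_prod_zero_field[OF assms(1)] by blast
    have "V\<^sup>T * V *\<^sub>v v = V\<^sup>T *\<^sub>v (V *\<^sub>v v)" using assms v by simp
    also have "\<dots> = 0\<^sub>v n" using assms v by auto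
    finally show False using assms(2) v by (auto simp: pd_mats_def)
  qed
  from det_non_zero_imp_unit[OF assms(1) this, of "()"]
  show ?thesis by (auto simp: Units_def ring_mat_simps)
qed

text \<open>With fewer than two blocks there are no pairs, so the cone contains only the zero matrix.\<close>

lemma pd_fw2_basis_two_blocks:
  assumes "is_partition n \<alpha>" "0 < n" "V \<in> carrier_mat n n" "X \<in> fw2_basis n \<alpha> V" "X \<in> pd_mats n"
  shows "2 \<le> length \<alpha>"
proof (rule ccontr)
  assume "\<not> 2 \<le> length \<alpha>"
  then have "block_pairs \<alpha> = {}" by (auto simp: block_pairs_def)
  interpret abelian_group "module_mat TYPE(real) n n" by (rule abelian_group_mat)
  from \<open>block_pairs \<alpha> = {}\<close> have "fw2 n \<alpha> = {0\<^sub>m n n}"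
    by (auto simp: fw2_def mat_sum_def module_mat_simps)
  then have "X = 0\<^sub>m n n" using assms by (auto simp: fw2_basis_def)
  moreover have "unit_vec n 0 \<bullet> (X *\<^sub>v unit_vec n 0) > 0"
    using assms by (simp add: pd_mats_def)
  ultimately show False by (simp add: zero_mult_mat_vec)
qed

lemma congruence_preimage:
  fixes V B Y :: "real mat"
  assumes V: "V \<in> carrier_mat n n" and B: "B \<in> carrier_mat n n" "B * V = 1\<^sub>m n"
    and Y: "Y \<in> carrier_mat n n"
  shows "V\<^sup>T * (B\<^sup>T * Y * B) * V = Y"
proof -
  have "V\<^sup>T * (B\<^sup>T * Y * B) * V = (V\<^sup>T * B\<^sup>T) * Y * (B * V)"
    using V B(1) Y by (simp add: assoc_mult_mat[of _ n n _ n _ n])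
  also have "V\<^sup>T * B\<^sup>T = 1\<^sub>m n"
    using transpose_mult[OF B(1) V] B(2) by simp
  finally show ?thesis using B(2) Y by simp
qed

text \<open>With \<open>B\<close> the inverse of \<open>V\<close>, congruence by \<open>V\<close> maps the identity to \<open>V\<^sup>T V\<close> and \<open>B\<^sup>T Y B\<close> to \<open>Y\<close>, so it
  maps the segment from the identity to \<open>B\<^sup>T Y B\<close> onto the segment from \<open>V\<^sup>T V\<close> to \<open>Y\<close>.\<close>

lemma step_towards_symmetric_matrix:
  assumes part: "is_partition n \<alpha>" and "2 \<le> length \<alpha>"
    and V: "V \<in> carrier_mat n n" and pd: "V\<^sup>T * V \<in> pd_mats n" and Y: "Y \<in> sym_mats n"
  shows "\<exists>\<epsilon> > 0. (1 - \<epsilon>) \<cdot>\<^sub>m (V\<^sup>T * V) + \<epsilon> \<cdot>\<^sub>m Y \<in> fw2_basis n \<alpha> V"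
proof -
  obtain B where B: "B \<in> carrier_mat n n" "B * V = 1\<^sub>m n"
    using gram_factor_invertible[OF V pd] by blast
  define S where "S = B\<^sup>T * Y * B"
  have S: "S \<in> sym_mats n" unfolding S_def by (rule sym_congruence[OF B(1) Y])
  then obtain \<epsilon> where \<epsilon>: "0 < \<epsilon>" "(1 - \<epsilon>) \<cdot>\<^sub>m 1\<^sub>m n + \<epsilon> \<cdot>\<^sub>m S \<in> fw2 n \<alpha>"
    using segment_from_identity_in_fw2[OF part assms(2)] by blast
  have "V\<^sup>T * S * V = Y"
    unfolding S_def using congruence_preimage[OF V B] Y by (simp add: sym_mats_def)
  moreover have "V\<^sup>T * 1\<^sub>m n * V = V\<^sup>T * V" using V by simp
  ultimately have "V\<^sup>T * ((1 - \<epsilon>) \<cdot>\<^sub>m 1\<^sub>m n + \<epsilon> \<cdot>\<^sub>m S) * V = (1 - \<epsilon>) \<cdot>\<^sub>m (V\<^sup>T * V) + \<epsilon> \<cdot>\<^sub>m Y"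
    using lincomb_congruence[OF V one_carrier_mat] S by (simp add: sym_mats_def)
  with \<epsilon>(2) have "(1 - \<epsilon>) \<cdot>\<^sub>m (V\<^sup>T * V) + \<epsilon> \<cdot>\<^sub>m Y \<in> fw2_basis n \<alpha> V"
    unfolding fw2_basis_def by (intro CollectI exI conjI) (rule sym)
  with \<epsilon>(1) show ?thesis by blast
qed

lemma primal_value_le_inner_value:
  assumes "is_partition n \<alpha>" "V \<in> carrier_mat n n"
  shows "primal_value n m A b C \<le> inner_value n m A b C \<alpha> V"
  unfolding primal_value_def inner_value_def
  using fw2_basis_subset_psd[OF assms]
  by (intro INF_superset_mono) (auto simp: primal_feasible_def inner_feasible_def)

theorem theorem2:
  fixes n m :: nat
    and A :: "nat \<Rightarrow> real mat" and b :: "real vec" and C :: "real mat"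
    and \<alpha> :: "nat list"
    and V X :: "nat \<Rightarrow> real mat"
    and t :: nat
  assumes "b \<in> carrier_vec m"
    and "C \<in> sym_mats n"
    and "\<And>i. i < m \<Longrightarrow> A i \<in> sym_mats n"
    and strong_duality: "primal_value n m A b C = dual_value n m A b C"
    and "is_partition n \<alpha>"
    and "inner_feasible n m A b \<alpha> (1\<^sub>m n) \<noteq> {}"
    and "V 1 = 1\<^sub>m n"
    and "\<And>s. 1 \<le> s \<Longrightarrow> inner_optimal n m A b C \<alpha> (V s) (X s)"
    and "\<And>s. 1 \<le> s \<Longrightarrow> is_cholesky_factor n (X s) (V (Suc s))"
    and "1 \<le> t"
    and "X t \<in> pd_mats n"
    and "inner_value n m A b C \<alpha> (V t) > primal_value n m A b C"
  shows "inner_value n m A b C \<alpha> (V t) > inner_value n m A b C \<alpha> (V (Suc t))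
       \<and> inner_value n m A b C \<alpha> (V (Suc t)) \<ge> primal_value n m A b C"
proof
  note part = assms(5)
  have C: "C \<in> carrier_mat n n" and A: "\<And>i. i < m \<Longrightarrow> A i \<in> carrier_mat n n"
    using assms(2,3) by (auto simp: sym_mats_def)
  have V: "V s \<in> carrier_mat n n" if "1 \<le> s" for s
  proof (cases "s = 1")
    case False
    then show ?thesis
      using that assms(9)[of "s - 1"] by (simp add: is_cholesky_factor_def)
  qed (use assms(7) in simp)
  let ?V = "V (Suc t)"
  have V_Suc: "?V \<in> carrier_mat n n" by (rule V) simp
  have X_eq: "X t = ?V\<^sup>T * ?V"
    using assms(9)[OF assms(10)] by (simp add: is_cholesky_factor_def)
  have X: "X t \<in> carrier_mat n n" using V_Suc X_eq by simp
  have opt: "X t \<in> inner_feasible n m A b \<alpha> (V t)"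
    "\<And>Y. Y \<in> inner_feasible n m A b \<alpha> (V t) \<Longrightarrow> mat_inner C (X t) \<le> mat_inner C Y"
    using assms(8)[OF assms(10)] by (force simp: inner_optimal_def is_arg_min_def)+
  have value_t: "inner_value n m A b C \<alpha> (V t) = mat_inner C (X t)"
    unfolding inner_value_def using opt by (intro antisym INF_lower INF_greatest) auto

  obtain Y where Y: "Y \<in> primal_feasible n m A b" and less: "mat_inner C Y < mat_inner C (X t)"
    using assms(12) unfolding value_t primal_value_def INF_less_iff by auto
  have Y_sym: "Y \<in> sym_mats n" and Yc: "Y \<in> carrier_mat n n"
    using Y by (auto simp: primal_feasible_def psd_mats_def sym_mats_def)

  have "0 < n"
  proof (rule ccontr)
    assume "\<not> 0 < n"
    then have "Y = X t" using X Yc by (intro eq_matI) auto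
    with less show False by simp
  qed
  then have "2 \<le> length \<alpha>"
    using pd_fw2_basis_two_blocks[OF part _ V[OF assms(10)] _ assms(11)] opt(1)
    by (simp add: inner_feasible_def)
  then obtain \<epsilon> where \<epsilon>: "0 < \<epsilon>" "(1 - \<epsilon>) \<cdot>\<^sub>m X t + \<epsilon> \<cdot>\<^sub>m Y \<in> fw2_basis n \<alpha> ?V"
    using step_towards_symmetric_matrix[OF part _ V_Suc _ Y_sym] assms(11) unfolding X_eq by blast
  let ?Z = "(1 - \<epsilon>) \<cdot>\<^sub>m X t + \<epsilon> \<cdot>\<^sub>m Y"
  have inner_Z: "mat_inner M ?Z = (1 - \<epsilon>) * mat_inner M (X t) + \<epsilon> * mat_inner M Y"
    if "M \<in> carrier_mat n n" for M
    by (rule mat_inner_lincomb[OF that X Yc])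
  have "mat_inner (A i) ?Z = b $ i" if "i < m" for i
    using inner_Z[OF A[OF that]] that opt(1) Y
    by (simp add: inner_feasible_def primal_feasible_def algebra_simps)
  then have "?Z \<in> inner_feasible n m A b \<alpha> ?V"
    using \<epsilon>(2) by (simp add: inner_feasible_def)
  then have "inner_value n m A b C \<alpha> ?V \<le> mat_inner C ?Z"
    unfolding inner_value_def by (rule INF_lower)
  also have "mat_inner C ?Z = mat_inner C (X t) - \<epsilon> * (mat_inner C (X t) - mat_inner C Y)"
    using inner_Z[OF C] by (simp add: algebra_simps)
  also have "ereal \<dots> < mat_inner C (X t)"
    using \<epsilon>(1) less by simp
  finally show "inner_value n m A b C \<alpha> ?V < inner_value n m A b C \<alpha> (V t)"
    by (simp add: value_t)

  show "primal_value n m A b C \<le> inner_value n m A b C \<alpha> ?V"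
    by (rule primal_value_le_inner_value[OF part V_Suc])
qed

end
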